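(* Let $X$ be a non-zero real Banach space. Then the Banach space $\ell^1(X)$ does not have Property P.
   Context: $\ell^1(X)$ is the Banach space of sequences $(x_n)_{n\in\mathbb{N}}$ in $X$ with $\|(x_n)\|=\sum_n\|x_n\|<\infty$. Let $Y$ be a normed space over $\mathbb{F}$ ($\mathbb{R}$ or $\mathbb{C}$). For $x,y\in Y$, $x$ is Birkhoff-James orthogonal to $y$, written $x\perp_{BJ}y$, if $\|x+\alpha y\|\ge\|x\|$ for all $\alpha\in\mathbb{F}$. For $\epsilon\in(0,1)$, $x$ is $\epsilon$-approximate Birkhoff-James orthogonal to $y$, written $x\perp^{\epsilon}_{BJ}y$, if $\|x+\alpha y\|^2\ge\|x\|^2-2\epsilon\|x\|\|\alpha y\|$ for all $\alpha\in\mathbb{F}$. A Banach space $Y$ over $\mathbb{F}$ has Property P if there exists $\epsilon\in(0,1)$ such that every bounded linear operator $T:Y\to Y$ satisfying "for all $x,y\in Y$, $x\perp_{BJ}y$ implies $T(x)\perp^{\epsilon}_{BJ}T(y)$" is a scalar multiple of an isometry (that is, there is $c\ge 0$ with $\|T(x)\|=c\|x\|$ for all $x\in Y$). *)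

theory Defs
  imports "HOL-Analysis.Analysis"
begin

section \<open>The Banach space of absolutely summable sequences in a Banach space\<close>

typedef (overloaded) ('a::real_normed_vector) l1 =
  "{x :: nat \<Rightarrow> 'a. summable (\<lambda>n. norm (x n))}"
  morphisms l1_nth Abs_l1
  by (rule exI[of _ "\<lambda>_. 0"]) simp

setup_lifting type_definition_l1

lemma summable_norm_l1_nth: "summable (\<lambda>n. norm (l1_nth x n))"
  using l1_nth[of x] by simp

lemma summable_norm_add:
  fixes x y :: "nat \<Rightarrow> 'a::real_normed_vector"
  assumes "summable (\<lambda>n. norm (x n))" "summable (\<lambda>n. norm (y n))"
  shows "summable (\<lambda>n. norm (x n + y n))"
  by (rule summable_comparison_test'[OF summable_add[OF assms]]) (auto intro: norm_triangle_ineq)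

instantiation l1 :: (real_normed_vector) real_normed_vector
begin

lift_definition zero_l1 :: "'a l1" is "\<lambda>_. 0"
  by simp

lift_definition plus_l1 :: "'a l1 \<Rightarrow> 'a l1 \<Rightarrow> 'a l1" is "\<lambda>x y n. x n + y n"
  by (rule summable_norm_add)

lift_definition uminus_l1 :: "'a l1 \<Rightarrow> 'a l1" is "\<lambda>x n. - x n"
  by simp

lift_definition minus_l1 :: "'a l1 \<Rightarrow> 'a l1 \<Rightarrow> 'a l1" is "\<lambda>x y n. x n - y n"
  using summable_norm_add[where y = "\<lambda>n. - y n" for y] by fastforce

lift_definition scaleR_l1 :: "real \<Rightarrow> 'a l1 \<Rightarrow> 'a l1" is "\<lambda>r x n. r *\<^sub>R x n"
  by (simp add: summable_mult)

lift_definition norm_l1 :: "'a l1 \<Rightarrow> real" is "\<lambda>x. \<Sum>n. norm (x n)" .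

definition dist_l1 :: "'a l1 \<Rightarrow> 'a l1 \<Rightarrow> real"
  where "dist_l1 x y = norm (x - y)"

definition sgn_l1 :: "'a l1 \<Rightarrow> 'a l1"
  where "sgn_l1 x = inverse (norm x) *\<^sub>R x"

definition uniformity_l1 :: "('a l1 \<times> 'a l1) filter"
  where "uniformity_l1 = (INF e\<in>{0<..}. principal {(x, y). dist x y < e})"

definition open_l1 :: "'a l1 set \<Rightarrow> bool"
  where "open_l1 S \<longleftrightarrow> (\<forall>x\<in>S. \<forall>\<^sub>F (x', y) in uniformity. x' = x \<longrightarrow> y \<in> S)"

instance
proof
  fix x y z :: "'a l1" and a b :: real
  show "x + y + z = x + (y + z)" by transfer (simp add: add.assoc)
  show "x + y = y + x" by transfer (simp add: add.commute)
  show "0 + x = x" by transfer simp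
  show "- x + x = 0" by transfer simp
  show "x - y = x + - y" by transfer simp
  show "a *\<^sub>R (x + y) = a *\<^sub>R x + a *\<^sub>R y" by transfer (simp add: scaleR_add_right)
  show "(a + b) *\<^sub>R x = a *\<^sub>R x + b *\<^sub>R x" by transfer (simp add: scaleR_add_left)
  show "a *\<^sub>R b *\<^sub>R x = (a * b) *\<^sub>R x" by transfer simp
  show "1 *\<^sub>R x = x" by transfer simp
  show "dist x y = norm (x - y)" by (rule dist_l1_def)
  show "sgn x = inverse (norm x) *\<^sub>R x" by (rule sgn_l1_def)
  show "uniformity = (INF e\<in>{0<..}. principal {(x, y :: 'a l1). dist x y < e})"
    by (rule uniformity_l1_def)
  show "open U \<longleftrightarrow> (\<forall>x\<in>U. \<forall>\<^sub>F (x', y) in uniformity. x' = x \<longrightarrow> y \<in> U)" for U :: "'a l1 set"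
    by (rule open_l1_def)
  show "norm x = 0 \<longleftrightarrow> x = 0"
    by transfer (auto simp: suminf_eq_zero_iff)
  show "norm (x + y) \<le> norm x + norm y"
  proof transfer
    fix x y :: "nat \<Rightarrow> 'a"
    assume x: "summable (\<lambda>n. norm (x n))" and y: "summable (\<lambda>n. norm (y n))"
    have "summable (\<lambda>n. norm (x n + y n))"
      by (rule summable_norm_add[OF x y])
    then have "(\<Sum>n. norm (x n + y n)) \<le> (\<Sum>n. norm (x n) + norm (y n))"
      by (intro suminf_le summable_add x y norm_triangle_ineq)
    also have "\<dots> = (\<Sum>n. norm (x n)) + (\<Sum>n. norm (y n))"
      by (rule suminf_add[symmetric, OF x y])
    finally show "(\<Sum>n. norm (x n + y n)) \<le> (\<Sum>n. norm (x n)) + (\<Sum>n. norm (y n))" .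
  qed
  show "norm (a *\<^sub>R x) = \<bar>a\<bar> * norm x"
    by transfer (simp add: suminf_mult)
qed

end

lemma sum_norm_le_norm_l1: "(\<Sum>n<k. norm (l1_nth x n)) \<le> norm x"
  unfolding norm_l1.rep_eq by (rule sum_le_suminf[OF summable_norm_l1_nth]) auto

lemma norm_l1_nth_le: "norm (l1_nth x n) \<le> norm x"
  using sum_norm_le_norm_l1[of x "Suc n"] sum_nonneg[of "{..<n}" "\<lambda>i. norm (l1_nth x i)"] by simp

instance l1 :: (banach) banach
proof
  fix X :: "nat \<Rightarrow> 'a l1"
  assume X: "Cauchy X"
  have "Cauchy (\<lambda>m. l1_nth (X m) n)" for n
  proof (rule metric_CauchyI)
    fix e :: real assume "0 < e"
    then obtain M where M: "\<And>m k. m \<ge> M \<Longrightarrow> k \<ge> M \<Longrightarrow> dist (X m) (X k) < e"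
      using metric_CauchyD[OF X] by metis
    have "dist (l1_nth (X m) n) (l1_nth (X k) n) \<le> dist (X m) (X k)" for m k
      using norm_l1_nth_le[of "X m - X k" n] by (simp add: dist_norm minus_l1.rep_eq)
    then show "\<exists>M. \<forall>m\<ge>M. \<forall>k\<ge>M. dist (l1_nth (X m) n) (l1_nth (X k) n) < e"
      using M by (meson le_less_trans)
  qed
  then have "\<exists>l. (\<lambda>m. l1_nth (X m) n) \<longlonglongrightarrow> l" for n
    using Cauchy_convergent convergent_def by blast
  then obtain L where L: "\<And>n. (\<lambda>m. l1_nth (X m) n) \<longlonglongrightarrow> L n"
    by metis
  have bound: "\<exists>M. \<forall>m\<ge>M. summable (\<lambda>n. norm (l1_nth (X m) n - L n)) \<and>
      (\<Sum>n. norm (l1_nth (X m) n - L n)) \<le> e" if "0 < e" for e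
  proof -
    obtain M where M: "\<And>m k. m \<ge> M \<Longrightarrow> k \<ge> M \<Longrightarrow> dist (X m) (X k) < e"
      using metric_CauchyD[OF X \<open>0 < e\<close>] by metis
    have part: "(\<Sum>n<j. norm (l1_nth (X m) n - L n)) \<le> e" if "m \<ge> M" for m j
    proof (rule LIMSEQ_le_const2)
      show "(\<lambda>k. \<Sum>n<j. norm (l1_nth (X m) n - l1_nth (X k) n))
          \<longlonglongrightarrow> (\<Sum>n<j. norm (l1_nth (X m) n - L n))"
        by (intro tendsto_intros L)
      have "(\<Sum>n<j. norm (l1_nth (X m) n - l1_nth (X k) n)) \<le> e" if "k \<ge> M" for k
        using sum_norm_le_norm_l1[of "X m - X k" j] M[OF \<open>m \<ge> M\<close> that]
        by (simp add: dist_norm minus_l1.rep_eq)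
      then show "\<exists>N. \<forall>k\<ge>N. (\<Sum>n<j. norm (l1_nth (X m) n - l1_nth (X k) n)) \<le> e"
        by blast
    qed
    have "summable (\<lambda>n. norm (l1_nth (X m) n - L n))" if "m \<ge> M" for m
      by (rule summableI_nonneg_bounded[OF _ part[OF that]]) simp
    then show ?thesis
      using suminf_le_const part by blast
  qed
  have sumL: "summable (\<lambda>n. norm (L n))"
  proof -
    obtain m where m: "summable (\<lambda>n. norm (l1_nth (X m) n - L n))"
      using bound[of 1] by auto
    show ?thesis
    proof (rule summable_comparison_test'[OF summable_add[OF m summable_norm_l1_nth[of "X m"]]])
      show "norm (norm (L n)) \<le> norm (l1_nth (X m) n - L n) + norm (l1_nth (X m) n)" for n
        using norm_triangle_sub[of "L n" "l1_nth (X m) n"] by (simp add: norm_minus_commute)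
    qed
  qed
  have nth: "l1_nth (Abs_l1 L) = L"
    using sumL by (simp add: Abs_l1_inverse)
  have "X \<longlonglongrightarrow> Abs_l1 L"
  proof (rule metric_LIMSEQ_I)
    fix e :: real assume "0 < e"
    then obtain M where M: "\<And>m. m \<ge> M \<Longrightarrow> (\<Sum>n. norm (l1_nth (X m) n - L n)) \<le> e / 2"
      using bound[of "e / 2"] by auto
    have "dist (X m) (Abs_l1 L) < e" if "m \<ge> M" for m
      using M[OF that] \<open>0 < e\<close> by (simp add: dist_norm norm_l1.rep_eq minus_l1.rep_eq nth)
    then show "\<exists>M. \<forall>m\<ge>M. dist (X m) (Abs_l1 L) < e"
      by blast
  qed
  then show "convergent X"
    by (rule convergentI)
qed


section \<open>Birkhoff-James orthogonality and Property P over the reals\<close>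

definition BJ_orthogonal :: "'b::real_normed_vector \<Rightarrow> 'b \<Rightarrow> bool"
  where "BJ_orthogonal x y \<longleftrightarrow> (\<forall>\<alpha>::real. norm (x + \<alpha> *\<^sub>R y) \<ge> norm x)"

definition approx_BJ_orthogonal :: "real \<Rightarrow> 'b::real_normed_vector \<Rightarrow> 'b \<Rightarrow> bool"
  where "approx_BJ_orthogonal \<epsilon> x y \<longleftrightarrow>
    (\<forall>\<alpha>::real. (norm (x + \<alpha> *\<^sub>R y))\<^sup>2 \<ge> (norm x)\<^sup>2 - 2 * \<epsilon> * norm x * norm (\<alpha> *\<^sub>R y))"

text \<open>The space is passed as a type, so that the operators range over all bounded linear
  self-maps of it.\<close>

definition property_P :: "'b::banach itself \<Rightarrow> bool"
  where "property_P (_ :: 'b itself) \<longleftrightarrow>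
    (\<exists>\<epsilon>::real. 0 < \<epsilon> \<and> \<epsilon> < 1 \<and>
      (\<forall>T :: 'b \<Rightarrow> 'b. bounded_linear T \<longrightarrow>
        (\<forall>x y. BJ_orthogonal x y \<longrightarrow> approx_BJ_orthogonal \<epsilon> (T x) (T y)) \<longrightarrow>
        (\<exists>c\<ge>0. \<forall>x. norm (T x) = c * norm x)))"

end

theory Submission
  imports Defs
begin

text \<open>
  Stretching a single coordinate of \<open>\<ell>\<^sup>1(X)\<close> by the factor \<open>1 + \<epsilon>\<close> gives an operator \<open>T\<close> that
  spoils Property P for the constant \<open>\<epsilon>\<close>. Because the norm is a sum over the coordinates,
  \<open>\<parallel>T x\<parallel> = \<parallel>x\<parallel> + \<epsilon> \<parallel>x\<^sub>k\<parallel>\<close>, which is not a multiple of \<open>\<parallel>x\<parallel>\<close>: a non-zero vector supported at \<open>k\<close> is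
  stretched and one supported elsewhere is not. If \<open>x\<close> is orthogonal to \<open>y\<close>, then passing from
  \<open>x\<close> to \<open>x + \<alpha> y\<close> cannot decrease the first summand, and by the triangle inequality it decreases
  the second one by at most \<open>\<epsilon> \<parallel>\<alpha> y\<^sub>k\<parallel> \<le> \<epsilon> \<parallel>\<alpha> T y\<parallel>\<close>. Hence
  \<open>\<parallel>T x + \<alpha> T y\<parallel> \<ge> \<parallel>T x\<parallel> - \<epsilon> \<parallel>\<alpha> T y\<parallel>\<close>, and squaring yields approximate orthogonality.
\<close>

text \<open>The quadratic bound in the definition is the square of the linear bound without its term of
  second order in \<open>\<alpha>\<close>, so it is weaker where the linear bound is nonnegative; where the linear
  bound is negative, the quadratic one is at most zero and holds trivially.\<close>

lemma approx_BJ_orthogonalI: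
  fixes x y :: "'b::real_normed_vector"
  assumes "\<And>\<alpha>::real. norm (x + \<alpha> *\<^sub>R y) \<ge> norm x - \<epsilon> * norm (\<alpha> *\<^sub>R y)"
  shows "approx_BJ_orthogonal \<epsilon> x y"
  unfolding approx_BJ_orthogonal_def
proof
  fix \<alpha> :: real
  let ?d = "\<epsilon> * norm (\<alpha> *\<^sub>R y)"
  have "(norm x)\<^sup>2 - 2 * (?d * norm x) \<le> (norm (x + \<alpha> *\<^sub>R y))\<^sup>2"
  proof (cases "?d \<le> norm x")
    case True
    have "(norm x)\<^sup>2 - 2 * (?d * norm x) \<le> (norm x - ?d)\<^sup>2"
      by (simp add: power2_diff)
    also have "\<dots> \<le> (norm (x + \<alpha> *\<^sub>R y))\<^sup>2"
      using True assms by (intro power_mono) auto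
    finally show ?thesis .
  next
    case False
    then have "(norm x)\<^sup>2 \<le> ?d * norm x"
      unfolding power2_eq_square by (intro mult_right_mono) auto
    moreover have "0 \<le> (norm x)\<^sup>2" "0 \<le> (norm (x + \<alpha> *\<^sub>R y))\<^sup>2"
      by auto
    ultimately show ?thesis
      by linarith
  qed
  then show "(norm x)\<^sup>2 - 2 * \<epsilon> * norm x * norm (\<alpha> *\<^sub>R y) \<le> (norm (x + \<alpha> *\<^sub>R y))\<^sup>2"
    by (simp only: mult_ac)
qed

lift_definition l1_single :: "nat \<Rightarrow> 'a::real_normed_vector \<Rightarrow> 'a l1"
  is "\<lambda>k a n. if n = k then a else 0"
  by (rule summable_finite[of "{k}" for k]) auto

lemma norm_l1_single: "norm (l1_single k a) = norm a"
  unfolding norm_l1.rep_eq l1_single.rep_eq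
  by (subst suminf_finite[of "{k}"]) auto

definition stretch :: "real \<Rightarrow> nat \<Rightarrow> 'a::real_normed_vector l1 \<Rightarrow> 'a l1"
  where "stretch r k x = x + l1_single k (r *\<^sub>R l1_nth x k)"

lemma norm_stretch:
  assumes "0 \<le> r"
  shows "norm (stretch r k x) = norm x + r * norm (l1_nth x k)"
proof -
  let ?s = "\<lambda>n. norm (l1_nth (l1_single k (r *\<^sub>R l1_nth x k)) n)"
  \<comment> \<open>At the coordinate \<open>k\<close> the two summands are nonnegative multiples of the same vector, so the
    triangle inequality is an equality there.\<close>
  have "norm (l1_nth (stretch r k x) n) = norm (l1_nth x n) + ?s n" for n
  proof (cases "n = k")
    case True
    have "l1_nth x k + r *\<^sub>R l1_nth x k = (1 + r) *\<^sub>R l1_nth x k"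
      by (simp add: scaleR_add_left)
    with True assms show ?thesis
      by (simp add: stretch_def plus_l1.rep_eq l1_single.rep_eq distrib_right)
  qed (simp add: stretch_def plus_l1.rep_eq l1_single.rep_eq)
  then have "norm (stretch r k x) = (\<Sum>n. norm (l1_nth x n) + ?s n)"
    by (simp add: norm_l1.rep_eq)
  also have "\<dots> = norm x + norm (l1_single k (r *\<^sub>R l1_nth x k))"
    unfolding norm_l1.rep_eq by (rule suminf_add[symmetric]; rule summable_norm_l1_nth)
  finally show ?thesis
    using assms by (simp add: norm_l1_single)
qed

lemma stretch_add: "stretch r k (x + y) = stretch r k x + stretch r k y"
  unfolding stretch_def by transfer (auto simp: fun_eq_iff scaleR_add_right)

lemma stretch_scaleR: "stretch r k (a *\<^sub>R x) = a *\<^sub>R stretch r k x"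
  unfolding stretch_def by transfer (auto simp: fun_eq_iff scaleR_add_right mult.commute)

lemma bounded_linear_stretch:
  assumes "0 \<le> r"
  shows "bounded_linear (stretch r k)"
proof (rule bounded_linear_intro[where K = "1 + r"])
  show "norm (stretch r k x) \<le> norm x * (1 + r)" for x :: "'a l1"
    using mult_left_mono[OF norm_l1_nth_le[of x k] assms]
    by (simp add: norm_stretch[OF assms] algebra_simps)
qed (simp_all add: stretch_add stretch_scaleR)

lemma stretch_approx_BJ_orthogonal:
  assumes r: "0 \<le> r" and orth: "BJ_orthogonal x y"
  shows "approx_BJ_orthogonal r (stretch r k x) (stretch r k y)"
proof (rule approx_BJ_orthogonalI)
  fix \<alpha> :: real
  let ?z = "x + \<alpha> *\<^sub>R y"
  have "norm (l1_nth x k) - norm (l1_nth (\<alpha> *\<^sub>R y) k) \<le> norm (l1_nth ?z k)"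
    unfolding plus_l1.rep_eq using norm_diff_ineq by blast
  then have "r * norm (l1_nth x k) - r * norm (l1_nth (\<alpha> *\<^sub>R y) k) \<le> r * norm (l1_nth ?z k)"
    using r by (metis mult_left_mono right_diff_distrib)
  moreover have "r * norm (l1_nth (\<alpha> *\<^sub>R y) k) \<le> r * norm (stretch r k (\<alpha> *\<^sub>R y))"
    using norm_l1_nth_le[of "\<alpha> *\<^sub>R y" k] r
    by (intro mult_left_mono) (auto simp: norm_stretch intro: add_increasing2)
  moreover have "norm x \<le> norm ?z"
    using orth unfolding BJ_orthogonal_def by blast
  ultimately have "norm (stretch r k x) - r * norm (stretch r k (\<alpha> *\<^sub>R y)) \<le> norm (stretch r k ?z)"
    unfolding norm_stretch[OF r, of k x] norm_stretch[OF r, of k ?z] by linarith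
  then show "norm (stretch r k x) - r * norm (\<alpha> *\<^sub>R stretch r k y)
      \<le> norm (stretch r k x + \<alpha> *\<^sub>R stretch r k y)"
    by (simp only: stretch_add stretch_scaleR)
qed

text \<open>Vectors supported at \<open>k\<close> and at another coordinate are scaled by \<open>1 + r\<close> and by \<open>1\<close>,
  respectively.\<close>

lemma stretch_not_scaled_isometry:
  fixes e :: "'a::real_normed_vector"
  assumes "e \<noteq> 0" "0 < r"
  shows "\<not> (\<forall>x :: 'a l1. norm (stretch r k x) = c * norm x)"
proof
  assume c: "\<forall>x :: 'a l1. norm (stretch r k x) = c * norm x"
  have "(1 + r) * norm e = c * norm e"
    using c[rule_format, of "l1_single k e"] \<open>0 < r\<close>
    by (simp add: norm_stretch norm_l1_single l1_single.rep_eq distrib_right)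
  moreover have "norm e = c * norm e"
    using c[rule_format, of "l1_single (Suc k) e"] \<open>0 < r\<close>
    by (simp add: norm_stretch norm_l1_single l1_single.rep_eq)
  ultimately show False
    using assms by (simp add: distrib_right)
qed

theorem theorem3p2:
  assumes "\<exists>x :: 'a::banach. x \<noteq> 0"
  shows "\<not> property_P TYPE('a l1)"
proof
  assume "property_P TYPE('a l1)"
  then obtain \<epsilon> :: real where "0 < \<epsilon>"
    and P: "\<And>T :: 'a l1 \<Rightarrow> 'a l1. bounded_linear T \<Longrightarrow>
      (\<forall>x y. BJ_orthogonal x y \<longrightarrow> approx_BJ_orthogonal \<epsilon> (T x) (T y)) \<Longrightarrow>
      \<exists>c\<ge>0. \<forall>x. norm (T x) = c * norm x"
    unfolding property_P_def by blast
  have "\<exists>c\<ge>0. \<forall>x :: 'a l1. norm (stretch \<epsilon> 0 x) = c * norm x"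
    using \<open>0 < \<epsilon>\<close> by (intro P bounded_linear_stretch) (auto intro: stretch_approx_BJ_orthogonal)
  then show False
    using assms stretch_not_scaled_isometry \<open>0 < \<epsilon>\<close> by blast
qed

end
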